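(* Let $a \geq 2$ be an integer and let $k$ be an even positive integer. Let $p(k,a)$ be the minimal order of a polyhedral graph containing a $k$-independent set of size $a$. Then \[p(k, a) = a + 3a\cdot\frac{k}{2} = \left(\frac{3}{2}k + 1\right)a.\]
   Context: Graphs are finite and simple. A polyhedral graph (or polyhedron) is a planar, $3$-connected graph; in particular it has at least $4$ vertices. The order of a graph is its number of vertices, and $d(u,v)$ denotes the graph distance between vertices $u$ and $v$. For a graph $G=(V,E)$ and an integer $k\ge 1$, a $k$-independent set is a subset $S\subseteq V$ such that any two distinct vertices $u,v\in S$ satisfy $d(u,v)>k$. *)

theory Defs
  imports
    "HOL-Analysis.Analysis"
    "Graph_Theory.Digraph_Component"
    "Graph_Theory.Shortest_Path"
begin

text \<open>
  Finite simple graphs are the \<open>pair_graph\<close>s of \<open>Graph_Theory\<close>: finite, symmetric, loop-free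
  relations, in which an edge \<open>uv\<close> appears as the two arcs \<open>(u, v)\<close> and \<open>(v, u)\<close>.
\<close>

definition graph_dist :: "'a pair_pre_digraph \<Rightarrow> 'a \<Rightarrow> 'a \<Rightarrow> ereal" where
  "graph_dist G u v = wf_digraph.\<mu> (with_proj G) (\<lambda>_. 1) u v"

text \<open>
  The plane is \<^typ>\<open>complex\<close>. An edge is drawn as a Jordan arc; the two orientations of an edge are
  drawn as the same arc, traversed in opposite directions.
\<close>

definition plane_drawing ::
    "'a pair_pre_digraph \<Rightarrow> ('a \<Rightarrow> complex) \<Rightarrow> ('a \<times> 'a \<Rightarrow> real \<Rightarrow> complex) \<Rightarrow> bool" where
  "plane_drawing G pos \<gamma> \<longleftrightarrow>
     inj_on pos (pverts G) \<and>
     (\<forall>(u, v) \<in> parcs G.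
        Path_Connected.arc (\<gamma> (u, v)) \<and>
        pathstart (\<gamma> (u, v)) = pos u \<and> pathfinish (\<gamma> (u, v)) = pos v \<and>
        \<gamma> (v, u) = reversepath (\<gamma> (u, v)) \<and>
        path_image (\<gamma> (u, v)) \<inter> pos ` pverts G = {pos u, pos v}) \<and>
     (\<forall>(u, v) \<in> parcs G. \<forall>(x, y) \<in> parcs G. {u, v} \<noteq> {x, y} \<longrightarrow>
        path_image (\<gamma> (u, v)) \<inter> path_image (\<gamma> (x, y)) \<subseteq> pos ` pverts G)"

definition planar :: "'a pair_pre_digraph \<Rightarrow> bool" where
  "planar G \<longleftrightarrow> (\<exists>pos \<gamma>. plane_drawing G pos \<gamma>)"

definition vertex_connected :: "nat \<Rightarrow> 'a pair_pre_digraph \<Rightarrow> bool" where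
  "vertex_connected n G \<longleftrightarrow>
     n < card (pverts G) \<and>
     (\<forall>X \<subseteq> pverts G. card X < n \<longrightarrow>
        Digraph_Component.connected (with_proj G \<restriction> (pverts G - X)))"

definition polyhedral :: "'a pair_pre_digraph \<Rightarrow> bool" where
  "polyhedral G \<longleftrightarrow> pair_graph G \<and> planar G \<and> vertex_connected 3 G"

definition k_independent :: "nat \<Rightarrow> 'a pair_pre_digraph \<Rightarrow> 'a set \<Rightarrow> bool" where
  "k_independent k G S \<longleftrightarrow>
     S \<subseteq> pverts G \<and> (\<forall>u \<in> S. \<forall>v \<in> S. u \<noteq> v \<longrightarrow> ereal (real k) < graph_dist G u v)"

text \<open>
  Every finite graph is isomorphic to one whose vertices are natural numbers, so restricting to
  vertex type \<^typ>\<open>nat\<close> loses no orders.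
\<close>

definition polyhedral_orders :: "nat \<Rightarrow> nat \<Rightarrow> nat set" where
  "polyhedral_orders k a =
     {card (pverts G) | G :: nat pair_pre_digraph.
        polyhedral G \<and> (\<exists>S. k_independent k G S \<and> card S = a)}"

text \<open>
  The value is unspecified if \<^term>\<open>polyhedral_orders k a\<close> is empty; it is the minimum exactly when
  \<^prop>\<open>min_polyhedral_order k a \<in> polyhedral_orders k a\<close>.
\<close>

definition min_polyhedral_order :: "nat \<Rightarrow> nat \<Rightarrow> nat" where
  "min_polyhedral_order k a = (LEAST n. n \<in> polyhedral_orders k a)"

end

theory Submission imports Defs begin

text \<open>
  Write \<open>k = 2m\<close>.

  Lower bound. The balls of radius \<open>m\<close> around the elements of a \<open>2m\<close>-independent set are
  pairwise disjoint, since a common vertex would give a path of length at most \<open>2m\<close> between two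
  centres. For \<open>1 \<le> j \<le> m\<close> the sphere of radius \<open>j\<close> around a centre cuts that centre off from
  every other centre, so in a 3-connected graph it has at least three vertices. Hence every ball
  has at least \<open>1 + 3m\<close> vertices (\<open>order_lower_bound\<close>).

  Upper bound. In an extremal graph the balls partition the vertices and all spheres have size
  three, which suggests the graph in the locale \<open>nest_ring\<close>. It consists of \<open>a\<close> copies of a
  \<open>nest\<close>: an apex inside \<open>m\<close> concentric triangles, with corresponding corners of consecutive
  triangles joined (and the apex joined to the innermost triangle). The nests stand in a row.
  Call the outer corners of a nest left, right and top; consecutive nests are linked by a top-top
  edge (\<open>upper\<close>) and a right-left edge (\<open>lower\<close>), and one closing edge joins the left corner of
  the first nest to the right corner of the last.

  Three properties are needed.
  \<^item> It is planar (\<open>planar_graph\<close>): explicit coordinates give a straight-line drawing.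
  \<^item> It is 3-connected (\<open>vertex_connected_graph\<close>): two deletions leave one of the three columns of
    a nest intact, and every surviving vertex of the nest is joined to it; two deletions destroy
    at most one pair of links, and if they do, the closing edge survives.
  \<^item> Distinct apexes have distance \<open>2m + 1\<close> or more (\<open>k_independent_apexes\<close>), as a path between
    them crosses all levels of two nests.
\<close>

section \<open>Distances and connectivity as statements about relations\<close>

lemma awalk_iff_relpow:
  assumes "pair_wf_digraph G" and "u \<in> pverts G"
  shows "(\<exists>p. pre_digraph.awalk (with_proj G) u p v \<and> length p = n) \<longleftrightarrow> (u, v) \<in> parcs G ^^ n"
proof -
  interpret pair_wf_digraph G by fact
  show ?thesis using assms(2)
  proof (induction n arbitrary: u)
    case 0
    then show ?case by (auto simp: awalk_Nil_iff)
  next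
    case (Suc n)
    show ?case
    proof
      assume "\<exists>p. awalk u p v \<and> length p = Suc n"
      then obtain e q where "awalk u (e # q) v" "length q = n"
        by (auto simp: length_Suc_conv)
      then have e: "e \<in> parcs G" "fst e = u" "awalk (snd e) q v"
        by (auto simp: awalk_Cons_iff)
      then have "(snd e, v) \<in> parcs G ^^ n"
        using Suc.IH[of "snd e"] \<open>length q = n\<close> arc_snd_in_verts by auto
      with e show "(u, v) \<in> parcs G ^^ Suc n"
        by (metis prod.collapse relpow_Suc_I2)
    next
      assume "(u, v) \<in> parcs G ^^ Suc n"
      then obtain w where w: "(u, w) \<in> parcs G" "(w, v) \<in> parcs G ^^ n"
        by (meson relpow_Suc_D2)
      then obtain p where "awalk w p v" "length p = n"
        using Suc.IH[of w] in_arcsD2 by blast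
      then have "awalk u ((u, w) # p) v \<and> length ((u, w) # p) = Suc n"
        using w by (simp add: awalk_Cons_iff)
      then show "\<exists>p. awalk u p v \<and> length p = Suc n" by blast
    qed
  qed
qed

text \<open>
  Independence becomes a statement about powers of the arc relation. This replaces the infimum of
  extended reals by induction on walks, and it is visibly invariant under relabelling.
\<close>
lemma graph_dist_gt_iff:
  assumes "pair_wf_digraph G" and "u \<in> pverts G"
  shows "ereal (real k) < graph_dist G u v \<longleftrightarrow> (\<forall>n\<le>k. (u, v) \<notin> parcs G ^^ n)"
proof -
  interpret pair_wf_digraph G by fact
  have cost: "awalk_cost (\<lambda>_. 1) p = real (length p)" for p :: "('a \<times> 'a) list"
    by (induction p) auto
  have dist: "graph_dist G u v = (INF p\<in>{p. awalk u p v}. ereal (real (length p)))"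
    by (simp add: graph_dist_def \<mu>_def cost)
  show ?thesis
  proof
    assume less: "ereal (real k) < graph_dist G u v"
    show "\<forall>n\<le>k. (u, v) \<notin> parcs G ^^ n"
    proof (intro allI impI notI)
      fix n assume "n \<le> k" "(u, v) \<in> parcs G ^^ n"
      then obtain p where "awalk u p v" "length p = n"
        using awalk_iff_relpow[OF assms] by blast
      then have "graph_dist G u v \<le> ereal (real n)"
        unfolding dist by (auto intro: INF_lower2)
      also have "\<dots> \<le> ereal (real k)" using \<open>n \<le> k\<close> by simp
      finally show False using less by simp
    qed
  next
    assume no_walk: "\<forall>n\<le>k. (u, v) \<notin> parcs G ^^ n"
    have "ereal (real (Suc k)) \<le> graph_dist G u v"
      unfolding dist
    proof (rule INF_greatest)
      fix p assume "p \<in> {p. awalk u p v}"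
      then have "(u, v) \<in> parcs G ^^ length p"
        using awalk_iff_relpow[OF assms] by blast
      then have "Suc k \<le> length p" using no_walk by (meson not_less_eq_eq)
      then show "ereal (real (Suc k)) \<le> ereal (real (length p))" by simp
    qed
    then show "ereal (real k) < graph_dist G u v"
      by (rule less_le_trans[rotated]) simp
  qed
qed

text \<open>
  Connectedness in the library refers to the symmetric closure of the arcs. For symmetric arcs it
  is plain reachability, which allows ordinary induction on the reflexive transitive closure.
\<close>
lemma connected_induced_iff:
  assumes "sym (parcs G)"
  shows "Digraph_Component.connected (with_proj G \<restriction> W) \<longleftrightarrow>
     W \<noteq> {} \<and> (\<forall>u\<in>W. \<forall>v\<in>W. (u, v) \<in> (Restr (parcs G) W)\<^sup>*)"
proof -
  let ?R = "Restr (parcs G) W"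
  have arcs: "arcs_ends (with_proj G \<restriction> W) = ?R"
    by (auto simp: arcs_ends_def arc_to_ends_def)
  have "(arcs_ends (with_proj G \<restriction> W))\<^sup>s = ?R"
    unfolding arcs symcl_def using assms by (auto dest: symD)
  moreover have "(u, v) \<in> rtrancl_on W ?R \<longleftrightarrow> (u, v) \<in> ?R\<^sup>*" if "u \<in> W" "v \<in> W" for u v
    using that by (auto intro: rtrancl_on_rtranclI rtrancl_consistent_rtrancl_on)
  ultimately show ?thesis by (auto simp: connected_conv)
qed

section \<open>The lower bound\<close>

definition dist_sphere :: "'a rel \<Rightarrow> 'a \<Rightarrow> nat \<Rightarrow> 'a set" where
  "dist_sphere R u j = {v. (u, v) \<in> R ^^ j \<and> (\<forall>i<j. (u, v) \<notin> R ^^ i)}"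

lemma dist_sphere_subset_verts:
  assumes "pair_wf_digraph G" and "u \<in> pverts G"
  shows "dist_sphere (parcs G) u j \<subseteq> pverts G"
proof -
  interpret pair_wf_digraph G by fact
  have "v \<in> pverts G" if "(u, v) \<in> parcs G ^^ j" for v
    using that assms(2) by (cases j) (auto dest: in_arcsD2)
  then show ?thesis by (auto simp: dist_sphere_def)
qed

lemma dist_sphere_disjoint:
  assumes "i \<noteq> j"
  shows "dist_sphere R u i \<inter> dist_sphere R u j = {}"
  using assms unfolding dist_sphere_def by (cases i j rule: linorder_cases) auto

text \<open>
  Along a walk the distance from \<open>u\<close> grows by at most one per step, so a walk avoiding the sphere
  of radius \<open>j\<close> never gets beyond distance \<open>j - 1\<close>.
\<close>
lemma dist_sphere_separates:
  assumes "(u, w) \<in> (Restr R (V - dist_sphere R u j))\<^sup>*" and "0 < j"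
  shows "\<exists>i<j. (u, w) \<in> R ^^ i"
  using assms(1)
proof (induction rule: rtrancl_induct)
  case base
  then show ?case using \<open>0 < j\<close> by (intro exI[of _ 0]) simp
next
  case (step v w)
  then obtain i where "i < j" "(u, v) \<in> R ^^ i" by blast
  moreover have "(v, w) \<in> R" "w \<notin> dist_sphere R u j" using step by auto
  ultimately have walk: "(u, w) \<in> R ^^ Suc i" and "Suc i \<le> j" by auto
  show ?case
  proof (cases "Suc i = j")
    case True
    then show ?thesis
      using walk \<open>w \<notin> dist_sphere R u j\<close> by (auto simp: dist_sphere_def)
  next
    case False
    then show ?thesis using walk \<open>Suc i \<le> j\<close> by (intro exI[of _ "Suc i"]) simp
  qed
qed

text \<open>
  The sphere of radius \<open>j\<close> separates \<open>u\<close> from any vertex \<open>w\<close> further away, so it is a vertex cut.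
\<close>
lemma card_dist_sphere_ge:
  assumes G: "pair_graph G" and conn: "vertex_connected n G"
    and uw: "u \<in> pverts G" "w \<in> pverts G" and far: "ereal (real j) < graph_dist G u w"
    and j: "0 < j"
  shows "n \<le> card (dist_sphere (parcs G) u j)"
proof (rule ccontr)
  interpret pair_graph G by fact
  let ?X = "dist_sphere (parcs G) u j"
  have wf: "pair_wf_digraph G" ..
  have sym: "sym (parcs G)"
    using arcs_symmetric by (auto intro: symI)
  have no_walk: "(u, w) \<notin> parcs G ^^ i" if "i \<le> j" for i
    using far that graph_dist_gt_iff[OF wf uw(1)] by blast
  assume "\<not> n \<le> card ?X"
  then have "Digraph_Component.connected (with_proj G \<restriction> (pverts G - ?X))"
    using conn dist_sphere_subset_verts[OF wf uw(1)] by (auto simp: vertex_connected_def)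
  moreover have "u \<in> pverts G - ?X" "w \<in> pverts G - ?X"
    using uw no_walk j by (auto simp: dist_sphere_def intro: relpow_0_I)
  ultimately have "(u, w) \<in> (Restr (parcs G) (pverts G - ?X))\<^sup>*"
    by (simp add: connected_induced_iff[OF sym])
  from dist_sphere_separates[OF this j] show False
    using no_walk by (auto dest: less_imp_le)
qed

text \<open>
  A second element of \<open>S\<close> is the far vertex that makes every sphere of radius at most \<open>m\<close> around
  the first one a cut. The factor two in \<open>2 * m\<close> makes the balls of radius \<open>m\<close> disjoint.
\<close>
lemma order_lower_bound:
  assumes G: "pair_graph G" and conn: "vertex_connected n G"
    and S: "k_independent (2 * m) G S" and card_S: "2 \<le> card S"
  shows "card S * (1 + n * m) \<le> card (pverts G)"
proof -
  interpret pair_graph G by fact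
  let ?R = "parcs G"
  let ?B = "\<lambda>u. \<Union>j\<le>m. dist_sphere ?R u j"
  have wf: "pair_wf_digraph G" ..
  have sym: "sym (?R ^^ i)" for i
  proof (induction i)
    case (Suc i)
    show ?case
    proof (rule symI)
      fix x y assume "(x, y) \<in> ?R ^^ Suc i"
      then obtain z where "(x, z) \<in> ?R ^^ i" "(z, y) \<in> ?R" by auto
      then have "(y, z) \<in> ?R" "(z, x) \<in> ?R ^^ i"
        using arcs_symmetric Suc.IH by (auto dest: symD)
      then show "(y, x) \<in> ?R ^^ Suc i" by (rule relpow_Suc_I2)
    qed
  qed (simp add: sym_Id)
  have SV: "S \<subseteq> pverts G" using S by (simp add: k_independent_def)
  then have fin_S: "finite S" using pair_finite_verts finite_subset by blast
  have sub: "dist_sphere ?R u j \<subseteq> pverts G" if "u \<in> S" for u j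
    using dist_sphere_subset_verts[OF wf] that SV by blast
  then have fin: "finite (dist_sphere ?R u j)" if "u \<in> S" for u j
    using that pair_finite_verts finite_subset by blast
  have far: "(u, w) \<notin> ?R ^^ i" if "u \<in> S" "w \<in> S" "u \<noteq> w" "i \<le> 2 * m" for u w i
    using S that SV graph_dist_gt_iff[OF wf, of u] unfolding k_independent_def by blast
  have ball: "1 + n * m \<le> card (?B u)" if u: "u \<in> S" for u
  proof -
    have "\<not> S \<subseteq> {u}" using card_S card_mono[of "{u}" S] by auto
    then obtain w where w: "w \<in> S" "w \<noteq> u" by blast
    have level: "n \<le> card (dist_sphere ?R u j)" if "j \<in> {1..m}" for j
    proof (rule card_dist_sphere_ge[OF G conn])
      show "ereal (real j) < graph_dist G u w"
        using that far[OF u w(1)] w(2) SV u graph_dist_gt_iff[OF wf, of u] by fastforce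
    qed (use that u w SV in auto)
    have "1 + n * m = card (dist_sphere ?R u 0) + (\<Sum>j\<in>{1..m}. n)"
      by (simp add: dist_sphere_def)
    also have "\<dots> \<le> card (dist_sphere ?R u 0) + (\<Sum>j\<in>{1..m}. card (dist_sphere ?R u j))"
      by (intro add_left_mono sum_mono level)
    also have "\<dots> = (\<Sum>j\<le>m. card (dist_sphere ?R u j))"
    proof -
      have "{..m} = insert 0 {1..m}" by auto
      then show ?thesis by simp
    qed
    also have "\<dots> = card (?B u)"
      by (intro card_UN_disjoint[symmetric] ballI impI dist_sphere_disjoint fin[OF u]) simp_all
    finally show ?thesis .
  qed
  have disj: "?B u \<inter> ?B w = {}" if uw: "u \<in> S" "w \<in> S" "u \<noteq> w" for u w
  proof (rule ccontr)
    assume "?B u \<inter> ?B w \<noteq> {}"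
    then obtain v i j where "i \<le> m" "j \<le> m" "(u, v) \<in> ?R ^^ i" "(w, v) \<in> ?R ^^ j"
      by (auto simp: dist_sphere_def)
    then have "(u, w) \<in> ?R ^^ (i + j)"
      using sym[of j] by (auto simp: relpow_add dest: symD)
    then show False using far[OF uw] \<open>i \<le> m\<close> \<open>j \<le> m\<close> by auto
  qed
  have "card S * (1 + n * m) \<le> (\<Sum>u\<in>S. card (?B u))"
    using sum_mono[of S "\<lambda>_. 1 + n * m", OF ball] by simp
  also have "\<dots> = card (\<Union>u\<in>S. ?B u)"
    by (intro card_UN_disjoint[symmetric] ballI impI disj fin_S finite_UN_I fin) simp_all
  also have "\<dots> \<le> card (pverts G)"
    using sub pair_finite_verts by (intro card_mono) auto
  finally show ?thesis .
qed


section \<open>Relabelling the vertices\<close>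

text \<open>
  The extremal graph is most readable on triples of natural numbers, whereas the orders in question
  are those of graphs on \<^typ>\<open>nat\<close>. All properties involved are invariant under injective
  relabelling.
\<close>
definition map_graph :: "('a \<Rightarrow> 'b) \<Rightarrow> 'a pair_pre_digraph \<Rightarrow> 'b pair_pre_digraph" where
  "map_graph f G = \<lparr> pverts = f ` pverts G, parcs = map_prod f f ` parcs G \<rparr>"

lemma map_graph_simps [simp]:
  "pverts (map_graph f G) = f ` pverts G"
  "parcs (map_graph f G) = map_prod f f ` parcs G"
  by (simp_all add: map_graph_def)

lemma pair_graphI:
  assumes "finite (pverts G)" and "parcs G \<subseteq> pverts G \<times> pverts G" and "sym (parcs G)"
    and "\<And>u. (u, u) \<notin> parcs G"
  shows "pair_graph G"
proof -
  have "finite (parcs G)"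
    using assms(1,2) finite_subset by blast
  then show ?thesis
    using assms by unfold_locales (auto simp: symmetric_def)
qed

lemma pair_graph_sym: "pair_graph G \<Longrightarrow> sym (parcs G)"
  by (auto intro!: symI dest: pair_sym_digraph.arcs_symmetric[rotated] simp: pair_graph_def pair_pseudo_graph_def)

lemma pair_graph_map_graph:
  assumes "pair_graph G" and "inj f"
  shows "pair_graph (map_graph f G)"
proof -
  interpret pair_graph G by fact
  show ?thesis
    using pair_finite_verts arcs_symmetric no_loops' in_arcsD1 in_arcsD2 \<open>inj f\<close>
    by (intro pair_graphI) (auto intro!: symI simp: inj_eq)
qed

lemma planar_map_graph:
  assumes "planar G" and "inj f"
  shows "planar (map_graph f G)"
proof -
  obtain pos \<gamma> where draw: "plane_drawing G pos \<gamma>"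
    using assms(1) by (auto simp: planar_def)
  let ?g = "inv f"
  have [simp]: "?g (f x) = x" for x using \<open>inj f\<close> by simp
  have img: "(\<lambda>x. pos (?g x)) ` f ` pverts G = pos ` pverts G"
    by (simp add: image_image)
  have ne: "{f u, f v} = {f x, f y} \<longleftrightarrow> {u, v} = {x, y}" for u v x y
    using \<open>inj f\<close> by (auto simp: doubleton_eq_iff inj_eq)
  have "plane_drawing (map_graph f G) (\<lambda>x. pos (?g x)) (\<lambda>(u, v). \<gamma> (?g u, ?g v))"
    unfolding plane_drawing_def map_graph_simps img
  proof (intro conjI ballI, goal_cases)
    case 1
    then show ?case using draw by (simp add: plane_drawing_def inj_on_def) blast
  next
    case (2 e)
    then obtain u v where "e = (f u, f v)" "(u, v) \<in> parcs G" by auto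
    then show ?case using draw by (simp add: plane_drawing_def) fast
  next
    case (3 e)
    then obtain u v where "e = (f u, f v)" "(u, v) \<in> parcs G" by auto
    then show ?case using draw by (simp add: plane_drawing_def ne case_prod_beta)
  qed
  then show ?thesis unfolding planar_def by blast
qed

lemma vertex_connected_map_graph:
  assumes "vertex_connected n G" and "sym (parcs G)" and "inj f"
  shows "vertex_connected n (map_graph f G)"
  unfolding vertex_connected_def
proof (intro conjI allI impI)
  show "n < card (pverts (map_graph f G))"
    using assms by (simp add: vertex_connected_def card_image inj_on_subset)
next
  fix Y assume "Y \<subseteq> pverts (map_graph f G)" and card_Y: "card Y < n"
  then obtain X where X: "X \<subseteq> pverts G" "Y = f ` X" by (auto simp: subset_image_iff)
  with card_Y have "card X < n"
    using \<open>inj f\<close> by (simp add: card_image inj_on_subset)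
  let ?W = "pverts G - X"
  have W: "pverts (map_graph f G) - Y = f ` ?W"
    using X \<open>inj f\<close> by (simp add: image_set_diff)
  have "Digraph_Component.connected (with_proj G \<restriction> ?W)"
    using assms(1) X(1) \<open>card X < n\<close> by (simp add: vertex_connected_def)
  then have conn: "?W \<noteq> {}" "\<And>u v. u \<in> ?W \<Longrightarrow> v \<in> ?W \<Longrightarrow> (u, v) \<in> (Restr (parcs G) ?W)\<^sup>*"
    unfolding connected_induced_iff[OF assms(2)] by auto
  have step: "(f u, f v) \<in> (Restr (parcs (map_graph f G)) (f ` ?W))\<^sup>*"
    if "(u, v) \<in> (Restr (parcs G) ?W)\<^sup>*" for u v
    using that
  proof (induction rule: rtrancl_induct)
    case (step v w)
    then have "(f v, f w) \<in> Restr (parcs (map_graph f G)) (f ` ?W)" by force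
    with step.IH show ?case by (rule rtrancl_into_rtrancl)
  qed simp
  have "sym (parcs (map_graph f G))"
    using assms(2) by (auto intro!: symI dest: symD)
  then show "Digraph_Component.connected (with_proj (map_graph f G) \<restriction> (pverts (map_graph f G) - Y))"
    unfolding W
  proof (subst connected_induced_iff, assumption, intro conjI ballI)
    show "f ` ?W \<noteq> {}" using conn(1) by simp
    fix x y assume "x \<in> f ` ?W" "y \<in> f ` ?W"
    then obtain u v where "u \<in> ?W" "v \<in> ?W" "x = f u" "y = f v" by blast
    then show "(x, y) \<in> (Restr (parcs (map_graph f G)) (f ` ?W))\<^sup>*"
      using step[OF conn(2)] by simp
  qed
qed

lemma polyhedral_map_graph:
  assumes "polyhedral G" and "inj f"
  shows "polyhedral (map_graph f G)"
  using assms pair_graph_sym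
  by (auto simp: polyhedral_def intro: pair_graph_map_graph planar_map_graph vertex_connected_map_graph)

lemma relpow_map_prod:
  assumes "inj f" and "(f u, y) \<in> (map_prod f f ` R) ^^ n"
  shows "\<exists>v. y = f v \<and> (u, v) \<in> R ^^ n"
  using assms(2)
proof (induction n arbitrary: y)
  case (Suc n)
  then obtain x where "(f u, x) \<in> map_prod f f ` R ^^ n" "(x, y) \<in> map_prod f f ` R" by auto
  moreover from Suc.IH[OF this(1)] obtain v where v: "x = f v" "(u, v) \<in> R ^^ n" by blast
  ultimately obtain w where "(v, w) \<in> R" "y = f w"
    using injD[OF \<open>inj f\<close>] by fastforce
  with v show ?case by (intro exI[of _ w]) auto
qed auto

lemma k_independent_map_graph:
  assumes "k_independent k G S" and G: "pair_graph G" and "inj f"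
  shows "k_independent k (map_graph f G) (f ` S)"
  unfolding k_independent_def
proof (intro conjI ballI impI)
  show "f ` S \<subseteq> pverts (map_graph f G)"
    using assms(1) by (auto simp: k_independent_def)
  fix x y assume "x \<in> f ` S" "y \<in> f ` S" "x \<noteq> y"
  then obtain u v where uv: "u \<in> S" "v \<in> S" "u \<noteq> v" "x = f u" "y = f v" by blast
  then have u: "u \<in> pverts G" and far: "ereal (real k) < graph_dist G u v"
    using assms(1) by (auto simp: k_independent_def)
  have wf: "pair_wf_digraph G" "pair_wf_digraph (map_graph f G)"
    using G pair_graph_map_graph[OF G \<open>inj f\<close>]
    by (auto simp: pair_graph_def pair_digraph_def pair_fin_digraph_def)
  have "(x, y) \<notin> parcs (map_graph f G) ^^ n" if "n \<le> k" for n
  proof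
    assume "(x, y) \<in> parcs (map_graph f G) ^^ n"
    then have "(u, v) \<in> parcs G ^^ n"
      using relpow_map_prod[OF \<open>inj f\<close>, of u y] \<open>inj f\<close> uv by (auto dest: injD)
    then show False using far that graph_dist_gt_iff[OF wf(1) u] by blast
  qed
  then show "ereal (real k) < graph_dist (map_graph f G) x y"
    using u uv by (subst graph_dist_gt_iff[OF wf(2)]) auto
qed

section \<open>Straight-line drawings\<close>

text \<open>
  A point common to two closed segments that is not the position of a vertex lies in both open
  segments, and these are the same for both orientations of an edge. So a drawing is verified by
  looking at the open segments of one orientation \<open>E\<close>.
\<close>
lemma planar_straight_line:
  fixes pos :: "'a \<Rightarrow> complex"
  assumes arcs: "parcs G = E \<union> E\<inverse>"
    and ends: "\<And>u v. (u, v) \<in> E \<Longrightarrow> u \<in> pverts G \<and> v \<in> pverts G \<and> u \<noteq> v"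
    and inj: "inj_on pos (pverts G)"
    and empty: "\<And>u v w. (u, v) \<in> E \<Longrightarrow> w \<in> pverts G \<Longrightarrow> pos w \<notin> open_segment (pos u) (pos v)"
    and cross: "\<And>u v x y p. (u, v) \<in> E \<Longrightarrow> (x, y) \<in> E \<Longrightarrow>
      p \<in> open_segment (pos u) (pos v) \<Longrightarrow> p \<in> open_segment (pos x) (pos y) \<Longrightarrow> (u, v) = (x, y)"
  shows "planar G"
proof -
  let ?\<gamma> = "\<lambda>(u, v). linepath (pos u) (pos v)"
  have arc: "u \<in> pverts G \<and> v \<in> pverts G \<and> pos u \<noteq> pos v \<and>
      (\<forall>w\<in>pverts G. pos w \<notin> open_segment (pos u) (pos v))" if "(u, v) \<in> parcs G" for u v
  proof -
    have one_way: "x \<in> pverts G \<and> y \<in> pverts G \<and> pos x \<noteq> pos y \<and>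
        (\<forall>w\<in>pverts G. pos w \<notin> open_segment (pos x) (pos y))" if "(x, y) \<in> E" for x y
      using ends[OF that] empty[OF that] inj_onD[OF inj, of x y] by blast
    show ?thesis
      using that one_way[of u v] one_way[of v u]
      unfolding arcs by (auto simp: open_segment_commute[of "pos v" "pos u"])
  qed
  have noncross: "closed_segment (pos u) (pos v) \<inter> closed_segment (pos x) (pos y) \<subseteq> pos ` pverts G"
    if "(u, v) \<in> parcs G" "(x, y) \<in> parcs G" "{u, v} \<noteq> {x, y}" for u v x y
  proof
    fix p assume p: "p \<in> closed_segment (pos u) (pos v) \<inter> closed_segment (pos x) (pos y)"
    show "p \<in> pos ` pverts G"
    proof (rule ccontr)
      assume "p \<notin> pos ` pverts G"
      with p arc that have
        "p \<in> open_segment (pos u) (pos v)" "p \<in> open_segment (pos v) (pos u)"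
        "p \<in> open_segment (pos x) (pos y)" "p \<in> open_segment (pos y) (pos x)"
        by (auto simp: open_segment_def closed_segment_commute)
      then show False
        using that cross[of u v x y p] cross[of v u x y p] cross[of u v y x p] cross[of v u y x p]
        unfolding arcs by auto
    qed
  qed
  have "plane_drawing G pos ?\<gamma>"
    unfolding plane_drawing_def
  proof (intro conjI inj ballI, goal_cases)
    case (1 e)
    obtain u v where e: "e = (u, v)" by fastforce
    have "closed_segment (pos u) (pos v) \<inter> pos ` pverts G = {pos u, pos v}"
      using 1 arc[of u v] unfolding e by (auto simp: open_segment_def)
    then show ?case using 1 arc[of u v] by (simp add: e arc_linepath)
  next
    case (2 e)
    obtain u v where e: "e = (u, v)" by fastforce
    have "closed_segment (pos u) (pos v) \<inter> closed_segment (pos (fst x)) (pos (snd x)) \<subseteq> pos ` pverts G"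
      if "x \<in> parcs G" "{u, v} \<noteq> {fst x, snd x}" for x
      using 2 that noncross[of u v "fst x" "snd x"] by (simp add: e)
    then show ?case by (simp add: e case_prod_beta)
  qed
  then show ?thesis unfolding planar_def by blast
qed


section \<open>A ring of nests\<close>

text \<open>
  The node \<open>(i, j, c)\<close> lies in nest \<open>i\<close>, at level \<open>j\<close> (the apex at level 0, the outer triangle at
  level \<open>m\<close>) and in column \<open>c\<close>, where 0, 1 and 2 stand for left, right and top. The three columns
  meet in the apex; at level 0 the column is therefore normalised to 0, which lets the edges from
  the apex to the innermost triangle be described like all other edges along a column.
\<close>
definition node :: "nat \<Rightarrow> nat \<Rightarrow> nat \<Rightarrow> nat \<times> nat \<times> nat" where
  "node i j c = (i, j, if j = 0 then 0 else c)"

lemma node_eq_iff: "node i j c = node i' j' c' \<longleftrightarrow> i = i' \<and> j = j' \<and> (j = 0 \<or> c = c')"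
  by (auto simp: node_def)

locale nest_ring =
  fixes a m :: nat
  assumes two_le_a: "2 \<le> a" and m_pos: "0 < m"
begin

definition nodes :: "(nat \<times> nat \<times> nat) set" where
  "nodes = {..<a} \<times> ({(0, 0)} \<union> {1..m} \<times> {..<3})"

inductive_set nest_edges :: "((nat \<times> nat \<times> nat) \<times> (nat \<times> nat \<times> nat)) set" where
  spoke: "i < a \<Longrightarrow> j < m \<Longrightarrow> c < 3 \<Longrightarrow> (node i j c, node i (Suc j) c) \<in> nest_edges"
| side: "i < a \<Longrightarrow> 0 < j \<Longrightarrow> j \<le> m \<Longrightarrow> c < d \<Longrightarrow> d < 3 \<Longrightarrow> (node i j c, node i j d) \<in> nest_edges"

inductive_set link_edges :: "((nat \<times> nat \<times> nat) \<times> (nat \<times> nat \<times> nat)) set" where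
  upper: "Suc i < a \<Longrightarrow> (node i m 2, node (Suc i) m 2) \<in> link_edges"
| lower: "Suc i < a \<Longrightarrow> (node i m 1, node (Suc i) m 0) \<in> link_edges"
| closing: "(node 0 m 0, node (a - 1) m 1) \<in> link_edges"

definition edges :: "((nat \<times> nat \<times> nat) \<times> (nat \<times> nat \<times> nat)) set" where
  "edges = nest_edges \<union> link_edges"

definition graph :: "(nat \<times> nat \<times> nat) pair_pre_digraph" where
  "graph = \<lparr> pverts = nodes, parcs = edges \<union> edges\<inverse> \<rparr>"

lemma graph_simps [simp]: "pverts graph = nodes" "parcs graph = edges \<union> edges\<inverse>"
  by (simp_all add: graph_def)

lemma card_nodes: "card nodes = a * (1 + 3 * m)"
proof -
  have "card ({(0::nat, 0::nat)} \<union> {1..m} \<times> {..<3}) = 1 + 3 * m"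
    by (subst card_Un_disjoint) (auto simp: card_cartesian_product)
  then show ?thesis unfolding nodes_def by (simp only: card_cartesian_product card_lessThan)
qed

lemma node_in_nodes_iff: "node i j c \<in> nodes \<longleftrightarrow> i < a \<and> j \<le> m \<and> (j = 0 \<or> c < 3)"
  by (auto simp: nodes_def node_def)

lemma nodesE:
  assumes "v \<in> nodes"
  obtains i j c where "v = node i j c" "i < a" "j \<le> m" "c < 3"
  using assms by (force simp: nodes_def node_def)

lemma edges_in_nodes:
  assumes "(u, v) \<in> edges"
  shows "u \<in> nodes \<and> v \<in> nodes \<and> u \<noteq> v"
  using assms unfolding edges_def
proof
  assume "(u, v) \<in> nest_edges"
  then show ?thesis by cases (auto simp: node_in_nodes_iff node_eq_iff)
next
  assume "(u, v) \<in> link_edges"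
  then show ?thesis using two_le_a m_pos by cases (auto simp: node_in_nodes_iff node_eq_iff)
qed

lemma pair_graph_graph: "pair_graph graph"
proof (rule pair_graphI)
  show "finite (pverts graph)" by (simp add: nodes_def)
  show "sym (parcs graph)" by (auto intro: symI)
  show "parcs graph \<subseteq> pverts graph \<times> pverts graph"
    using edges_in_nodes by (intro subrelI) auto
  show "(u, u) \<notin> parcs graph" for u
    using edges_in_nodes[of u u] by auto
qed

subsection \<open>The drawing\<close>

text \<open>
  Nest \<open>i\<close> is centred at \<open>(3mi, 0)\<close>. A point of it is given by three coordinates, its amounts in the
  directions left, right and top, which are \<open>(-1, -drop_left i)\<close>, \<open>(1, -drop_right i)\<close> and \<open>(0, 1)\<close>.
  The bottom corners lie at height \<open>-m\<close> except for the endpoints of the closing edge, which lie at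
  height \<open>-2m\<close>: so that edge passes below everything else.
\<close>
definition drop_left :: "nat \<Rightarrow> real" where
  "drop_left i = (if i = 0 then 2 else 1)"

definition drop_right :: "nat \<Rightarrow> real" where
  "drop_right i = (if i = a - 1 then 2 else 1)"

definition place :: "nat \<Rightarrow> (nat \<Rightarrow> real) \<Rightarrow> complex" where
  "place i \<xi> = Complex (real i * (3 * real m) + \<xi> 1 - \<xi> 0)
     (\<xi> 2 - drop_left i * \<xi> 0 - drop_right i * \<xi> 1)"

text \<open>
  A positive combination of the three directions vanishes, so coordinates become unique only once
  one of them is required to be zero. The bound on the sum describes the outer triangle. Indices
  from 3 on carry no meaning and are set to zero to make equality of coordinates an equality of
  functions.
\<close>
definition nest_coords :: "(nat \<Rightarrow> real) set" where
  "nest_coords = {\<xi>. (\<forall>c. 0 \<le> \<xi> c) \<and> (\<forall>c\<ge>3. \<xi> c = 0) \<and> (\<exists>c<3. \<xi> c = 0) \<and> \<xi> 0 + \<xi> 1 + \<xi> 2 \<le> real m}"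

definition axis :: "nat \<Rightarrow> real \<Rightarrow> nat \<Rightarrow> real" where
  "axis c t = (\<lambda>d. if d = c then t else 0)"

definition pos :: "nat \<times> nat \<times> nat \<Rightarrow> complex" where
  "pos v = (case v of (i, j, c) \<Rightarrow> place i (axis c (real j)))"

lemma less_3_cases: "c < (3::nat) \<longleftrightarrow> c = 0 \<or> c = 1 \<or> c = 2"
  by auto

text \<open>At level 0 all columns give the centre, so the normalisation in \<^const>\<open>node\<close> is harmless.\<close>
lemma pos_node: "pos (node i j c) = place i (axis c (real j))"
  by (auto simp: pos_def node_def axis_def place_def)

lemma axis_in_nest_coords:
  assumes "c < 3" "0 \<le> t" "t \<le> real m"
  shows "axis c t \<in> nest_coords"
proof -
  have "\<exists>d<3. d \<noteq> c" by (rule exI[of _ "if c = 0 then 1 else 0"]) simp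
  then show ?thesis
    using assms by (auto simp: nest_coords_def axis_def less_3_cases)
qed

lemma nest_coords_cases:
  assumes "\<xi> \<in> nest_coords"
  shows "0 \<le> \<xi> 0" "0 \<le> \<xi> 1" "0 \<le> \<xi> 2" "\<xi> 0 + \<xi> 1 + \<xi> 2 \<le> real m"
    "\<xi> 0 = 0 \<or> \<xi> 1 = 0 \<or> \<xi> 2 = 0"
  using assms by (auto simp: nest_coords_def less_3_cases)

lemma Re_place_bounds:
  assumes "\<xi> \<in> nest_coords"
  shows "real i * (3 * real m) - real m \<le> Re (place i \<xi>)"
    and "Re (place i \<xi>) \<le> real i * (3 * real m) + real m"
  using nest_coords_cases[OF assms] by (simp_all add: place_def)

lemma strip_mono:
  assumes "i < k"
  shows "real i * (3 * real m) + 3 * real m \<le> real k * (3 * real m)"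
proof -
  have "(real i + 1) * (3 * real m) \<le> real k * (3 * real m)"
    using assms by (intro mult_right_mono) auto
  then show ?thesis by (simp add: algebra_simps)
qed

text \<open>
  Distinct nests occupy disjoint vertical strips. Within a nest, the linear relations between the
  three directions are the multiples of \<open>(1, 1, drop_left i + drop_right i)\<close>, all of whose entries
  are positive. Two coordinate triples of one point therefore differ by a triple with entries of one
  strict sign or by zero; the former is impossible as both triples are nonnegative with a zero entry.
\<close>
lemma place_inj:
  assumes eq: "place i \<xi> = place k \<mu>" and "\<xi> \<in> nest_coords" "\<mu> \<in> nest_coords"
  shows "i = k \<and> \<xi> = \<mu>"
proof -
  have "i = k"
  proof (rule ccontr)
    assume "i \<noteq> k"
    then consider "i < k" | "k < i" by linarith
    then show False
      using Re_place_bounds[OF assms(2), of i] Re_place_bounds[OF assms(3), of k]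
        strip_mono[of i k] strip_mono[of k i] m_pos eq by cases auto
  qed
  define \<delta> where "\<delta> = \<mu> 0 - \<xi> 0"
  have \<delta>: "\<mu> 0 = \<xi> 0 + \<delta>" "\<mu> 1 = \<xi> 1 + \<delta>"
    using eq by (simp_all add: \<delta>_def place_def \<open>i = k\<close>)
  have "\<mu> 2 = \<xi> 2 + (drop_left i + drop_right i) * \<delta>"
  proof -
    have "\<xi> 2 - drop_left k * \<xi> 0 - drop_right k * \<xi> 1 = \<mu> 2 - drop_left k * \<mu> 0 - drop_right k * \<mu> 1"
      using eq by (simp add: place_def \<open>i = k\<close>)
    then show ?thesis unfolding \<delta> \<open>i = k\<close> by (simp add: algebra_simps)
  qed
  moreover have drops: "0 < drop_left i + drop_right i"
    by (simp add: drop_left_def drop_right_def)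
  moreover have "\<not> 0 < \<delta>"
  proof
    assume "0 < \<delta>"
    then have "0 < (drop_left i + drop_right i) * \<delta>" using drops by simp
    then show False
      using nest_coords_cases[OF assms(2)] nest_coords_cases(5)[OF assms(3)] \<delta> \<open>0 < \<delta>\<close> calculation
      by linarith
  qed
  moreover have "\<not> \<delta> < 0"
  proof
    assume "\<delta> < 0"
    then have "(drop_left i + drop_right i) * \<delta> < 0" using drops by (simp add: mult_pos_neg)
    then show False
      using nest_coords_cases[OF assms(3)] nest_coords_cases(5)[OF assms(2)] \<delta> \<open>\<delta> < 0\<close> calculation
      by linarith
  qed
  ultimately have "\<delta> = 0" by linarith
  have "\<xi> c = \<mu> c" for c
  proof (cases "c < 3")
    case True
    then show ?thesis
      using \<open>\<delta> = 0\<close> \<delta> \<open>\<mu> 2 = _\<close> by (auto simp: less_3_cases)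
  next
    case False
    then show ?thesis using assms(2,3) by (simp add: nest_coords_def)
  qed
  with \<open>i = k\<close> show ?thesis by auto
qed

lemma place_segment:
  assumes "p \<in> open_segment (place i \<xi>) (place i \<mu>)"
  obtains t where "0 < t" "t < 1" "p = place i (\<lambda>c. (1 - t) * \<xi> c + t * \<mu> c)"
proof -
  from assms obtain t where "0 < t" "t < 1" "p = (1 - t) *\<^sub>R place i \<xi> + t *\<^sub>R place i \<mu>"
    by (auto simp: in_segment)
  moreover have "(1 - t) *\<^sub>R place i \<xi> + t *\<^sub>R place i \<mu> = place i (\<lambda>c. (1 - t) * \<xi> c + t * \<mu> c)"
    by (simp add: complex_eq_iff place_def algebra_simps)
  ultimately show thesis using that by metis
qed

text \<open>
  \<open>carries e i \<xi>\<close>: the point of nest \<open>i\<close> with coordinates \<open>\<xi>\<close> is an interior point of the edge \<open>e\<close>.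
  The edge can be read off from \<open>\<xi>\<close>: its nonzero entries name the columns involved, and their
  sum determines the level. This is why two edges of nests never cross.
\<close>
inductive carries :: "(nat \<times> nat \<times> nat) \<times> (nat \<times> nat \<times> nat) \<Rightarrow> nat \<Rightarrow> (nat \<Rightarrow> real) \<Rightarrow> bool" where
  carries_spoke: "j < m \<Longrightarrow> c < 3 \<Longrightarrow> real j < t \<Longrightarrow> t < real (Suc j) \<Longrightarrow>
    carries (node i j c, node i (Suc j) c) i (axis c t)"
| carries_side: "j \<le> m \<Longrightarrow> c < d \<Longrightarrow> d < 3 \<Longrightarrow> 0 < s \<Longrightarrow> 0 < t \<Longrightarrow> s + t = real j \<Longrightarrow>
    carries (node i j c, node i j d) i (\<lambda>b. axis c s b + axis d t b)"

lemma nest_edge_carries: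
  assumes "(u, v) \<in> nest_edges" and "p \<in> open_segment (pos u) (pos v)"
  shows "\<exists>i \<xi>. p = place i \<xi> \<and> carries (u, v) i \<xi>"
  using assms(1)
proof cases
  case (spoke i j c)
  then obtain t where t: "0 < t" "t < 1"
    "p = place i (\<lambda>b. (1 - t) * axis c (real j) b + t * axis c (real (Suc j)) b)"
    using assms(2) by (auto simp: pos_node elim: place_segment)
  moreover have "(\<lambda>b. (1 - t) * axis c (real j) b + t * axis c (real (Suc j)) b) = axis c (real j + t)"
    by (auto simp: axis_def algebra_simps)
  moreover have "carries (u, v) i (axis c (real j + t))"
    using spoke t by (auto intro: carries_spoke)
  ultimately show ?thesis by auto
next
  case (side i j c d)
  then obtain t where t: "0 < t" "t < 1"
    "p = place i (\<lambda>b. (1 - t) * axis c (real j) b + t * axis d (real j) b)"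
    using assms(2) by (auto simp: pos_node elim: place_segment)
  moreover have "(\<lambda>b. (1 - t) * axis c (real j) b + t * axis d (real j) b) =
      (\<lambda>b. axis c ((1 - t) * real j) b + axis d (t * real j) b)"
    by (auto simp: axis_def)
  moreover have "carries (u, v) i (\<lambda>b. axis c ((1 - t) * real j) b + axis d (t * real j) b)"
    unfolding side(1,2) by (rule carries_side) (use side t in \<open>auto simp: algebra_simps\<close>)
  ultimately show ?thesis by auto
qed

lemma carries_nest_coords:
  assumes "carries e i \<xi>"
  shows "\<xi> \<in> nest_coords"
  using assms
proof cases
  case (carries_spoke j c t)
  then show ?thesis by (auto intro!: axis_in_nest_coords)
next
  case (carries_side j c d s t)
  have cd: "c = 0 \<and> d = 1 \<or> c = 0 \<and> d = 2 \<or> c = 1 \<and> d = 2"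
    using carries_side(4,5) by linarith
  then have "\<xi> 0 + \<xi> 1 + \<xi> 2 = s + t"
    by (elim disjE) (simp_all add: carries_side(2) axis_def)
  moreover have "\<xi> (3 - (c + d)) = 0"
    using cd by (elim disjE) (simp_all add: carries_side(2) axis_def)
  moreover have "3 - (c + d) < 3" using carries_side(4) by linarith
  moreover have "0 \<le> \<xi> b" "3 \<le> b \<Longrightarrow> \<xi> b = 0" for b
    using carries_side(4-7) by (simp_all add: carries_side(2) axis_def)
  ultimately show ?thesis
    using carries_side(3,8) unfolding nest_coords_def mem_Collect_eq
    by (metis of_nat_le_iff)
qed

lemma carries_support:
  assumes "carries e i \<xi>"
  shows "(\<exists>j c. e = (node i j c, node i (Suc j) c) \<and> {b. \<xi> b \<noteq> 0} = {c} \<and>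
            real j < \<xi> c \<and> \<xi> c < real (Suc j)) \<or>
    (\<exists>j c d. e = (node i j c, node i j d) \<and> c < d \<and> {b. \<xi> b \<noteq> 0} = {c, d} \<and> \<xi> c + \<xi> d = real j)"
  using assms
proof cases
  case (carries_spoke j c t)
  then show ?thesis by (intro disjI1 exI[of _ j] exI[of _ c]) (auto simp: axis_def)
next
  case (carries_side j c d s t)
  then show ?thesis
    by (intro disjI2 exI[of _ j] exI[of _ c] exI[of _ d]) (auto simp: axis_def)
qed

lemma carries_unique:
  assumes "carries e i \<xi>" and "carries e' i \<xi>"
  shows "e = e'"
  using carries_support[OF assms(1)]
proof (elim disjE exE conjE)
  fix j c
  assume e: "e = (node i j c, node i (Suc j) c)" "{b. \<xi> b \<noteq> 0} = {c}"
    "real j < \<xi> c" "\<xi> c < real (Suc j)"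
  from carries_support[OF assms(2)] show ?thesis
  proof (elim disjE exE conjE)
    fix j' c'
    assume e': "e' = (node i j' c', node i (Suc j') c')" "{b. \<xi> b \<noteq> 0} = {c'}"
      "real j' < \<xi> c'" "\<xi> c' < real (Suc j')"
    then have "c' = c" using e by auto
    moreover have "real j' < real (Suc j)" "real j < real (Suc j')"
      using e(3,4) e'(3,4) unfolding \<open>c' = c\<close> by linarith+
    then have "j' = j" by simp
    ultimately show ?thesis using e e' by simp
  qed (use e in auto)
next
  fix j c d
  assume e: "e = (node i j c, node i j d)" "c < d" "{b. \<xi> b \<noteq> 0} = {c, d}" "\<xi> c + \<xi> d = real j"
  from carries_support[OF assms(2)] show ?thesis
  proof (elim disjE exE conjE)
    fix j' c' d'
    assume e': "e' = (node i j' c', node i j' d')" "c' < d'" "{b. \<xi> b \<noteq> 0} = {c', d'}"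
      "\<xi> c' + \<xi> d' = real j'"
    then have "c' = c \<and> d' = d" using e by (auto simp: doubleton_eq_iff)
    then show ?thesis using e e' by simp
  qed (use e in auto)
qed

lemma not_carries_axis: "\<not> carries e i (axis c (real j))"
proof
  assume "carries e i (axis c (real j))"
  from carries_support[OF this] show False
  proof (elim disjE exE conjE)
    fix j' c' assume *: "{b. axis c (real j) b \<noteq> 0} = {c'}" "real j' < axis c (real j) c'" "axis c (real j) c' < real (Suc j')"
    then have "c' = c" by (auto simp: axis_def split: if_splits)
    then show False using * by (simp add: axis_def)
  next
    fix j' c' d assume *: "{b. axis c (real j) b \<noteq> 0} = {c', d}" "c' < d"
    have "{b. axis c (real j) b \<noteq> 0} \<subseteq> {c}" by (auto simp: axis_def)
    with * show False by auto
  qed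
qed

lemma inj_on_pos: "inj_on pos nodes"
proof (rule inj_onI)
  fix u v assume "u \<in> nodes" "v \<in> nodes" and eq: "pos u = pos v"
  then obtain i j c i' j' c' where uv: "u = node i j c" "j \<le> m" "c < 3" "v = node i' j' c'" "j' \<le> m" "c' < 3"
    by (metis nodesE)
  then have "i = i' \<and> axis c (real j) = axis c' (real j')"
    using eq by (intro place_inj axis_in_nest_coords) (auto simp: pos_node)
  then show "u = v"
    using uv by (auto simp: node_eq_iff axis_def fun_eq_iff split: if_splits)
qed

text \<open>
  All links are horizontal: top-top links at height \<open>m\<close>, right-left links at height \<open>-m\<close>, and the
  closing edge at height \<open>-2m\<close>. Zones of different links are disjoint.
\<close>
inductive link_zone :: "(nat \<times> nat \<times> nat) \<times> (nat \<times> nat \<times> nat) \<Rightarrow> complex \<Rightarrow> bool" where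
  zone_upper: "Im p = real m \<Longrightarrow> real i * (3 * real m) < Re p \<Longrightarrow> Re p < real (Suc i) * (3 * real m) \<Longrightarrow>
    link_zone (node i m 2, node (Suc i) m 2) p"
| zone_lower: "Im p = - real m \<Longrightarrow> real i * (3 * real m) + real m < Re p \<Longrightarrow>
    Re p < real (Suc i) * (3 * real m) - real m \<Longrightarrow>
    link_zone (node i m 1, node (Suc i) m 0) p"
| zone_closing: "Im p = - 2 * real m \<Longrightarrow> - real m < Re p \<Longrightarrow> Re p < real (a - 1) * (3 * real m) + real m \<Longrightarrow>
    link_zone (node 0 m 0, node (a - 1) m 1) p"

lemma horizontal_segment:
  assumes "p \<in> open_segment (Complex x y) (Complex x' y)" and "x < x'"
  shows "Im p = y \<and> x < Re p \<and> Re p < x'"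
proof -
  from assms(1) obtain t where t: "0 < t" "t < 1"
    "p = (1 - t) *\<^sub>R Complex x y + t *\<^sub>R Complex x' y"
    by (auto simp: in_segment)
  have "Re p = (1 - t) * x + t * x'" "Im p = (1 - t) * y + t * y" by (simp_all add: t(3))
  then have "Re p = x + t * (x' - x)" "x' - Re p = (1 - t) * (x' - x)" "Im p = y"
    by (simp_all add: algebra_simps)
  moreover have "0 < t * (x' - x)" "0 < (1 - t) * (x' - x)" using t assms(2) by simp_all
  ultimately show ?thesis by linarith
qed

lemma link_edge_zone:
  assumes "(u, v) \<in> link_edges" and "p \<in> open_segment (pos u) (pos v)"
  shows "link_zone (u, v) p"
  using assms(1)
proof cases
  case (upper i)
  then show ?thesis
    using assms(2) m_pos
    by (auto simp: pos_node place_def axis_def intro!: zone_upper dest!: horizontal_segment)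
next
  case (lower i)
  have "pos u = Complex (real i * (3 * real m) + real m) (- real m)"
    "pos v = Complex (real (Suc i) * (3 * real m) - real m) (- real m)"
    using lower by (simp_all add: pos_node place_def axis_def drop_left_def drop_right_def)
  moreover have "real i * (3 * real m) + real m < real (Suc i) * (3 * real m) - real m"
    using m_pos by (simp add: algebra_simps)
  ultimately have "Im p = - real m \<and> real i * (3 * real m) + real m < Re p \<and>
      Re p < real (Suc i) * (3 * real m) - real m"
    using assms(2) by (intro horizontal_segment) simp_all
  then show ?thesis unfolding lower(1,2) by (intro zone_lower) simp_all
next
  case closing
  have "0 \<le> real (a - 1) * (3 * real m)" by simp
  then have "- real m < real (a - 1) * (3 * real m) + real m" using m_pos by linarith
  moreover have "pos u = Complex (- real m) (- 2 * real m)"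
    "pos v = Complex (real (a - 1) * (3 * real m) + real m) (- 2 * real m)"
    using closing by (simp_all add: pos_node place_def axis_def drop_left_def drop_right_def)
  ultimately have "Im p = - 2 * real m \<and> - real m < Re p \<and>
      Re p < real (a - 1) * (3 * real m) + real m"
    using assms(2) by (intro horizontal_segment) simp_all
  then show ?thesis unfolding closing by (intro zone_closing) simp_all
qed

lemma link_zone_unique:
  assumes "link_zone e p" and "link_zone e' p"
  shows "e = e'"
proof -
  have strip: "i = k" if "real i * (3 * real m) < x" "x < real (Suc i) * (3 * real m)"
      "real k * (3 * real m) < x" "x < real (Suc k) * (3 * real m)" for i k x
  proof (rule ccontr)
    assume "i \<noteq> k"
    then consider "i < k" | "k < i" by linarith
    then show False
      using that strip_mono[of i k] strip_mono[of k i] by cases (auto simp: algebra_simps)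
  qed
  show ?thesis
    using assms(1)
  proof cases
    case (zone_upper i)
    with assms(2) show ?thesis
      using m_pos by cases (auto dest: strip)
  next
    case (zone_lower i)
    note z = this
    from assms(2) show ?thesis
    proof cases
      case (zone_lower k)
      then have "i = k" using z m_pos by (intro strip[of _ "Re p"]) auto
      then show ?thesis using z zone_lower by simp
    qed (use z m_pos in auto)
  next
    case zone_closing
    with assms(2) show ?thesis
      using m_pos by cases auto
  qed
qed

text \<open>
  Links avoid the nests: a nest reaches height \<open>m\<close> only in its top corner and height \<open>-2m\<close> only in
  an endpoint of the closing edge, and right-left links run in the gaps between the strips.
\<close>
lemma place_not_link_zone:
  assumes "\<xi> \<in> nest_coords"
  shows "\<not> link_zone e (place i \<xi>)"
proof
  note \<xi> = nest_coords_cases[OF assms]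
  have drops: "\<xi> 0 \<le> drop_left i * \<xi> 0" "\<xi> 1 \<le> drop_right i * \<xi> 1"
    "drop_left i * \<xi> 0 \<le> 2 * \<xi> 0" "drop_right i * \<xi> 1 \<le> 2 * \<xi> 1"
    using \<xi> by (auto simp: drop_left_def drop_right_def)
  assume "link_zone e (place i \<xi>)"
  then show False
  proof cases
    case (zone_upper k)
    have "\<xi> 0 = 0" "\<xi> 1 = 0"
      using zone_upper(2) \<xi> drops by (simp_all add: place_def)
    then have "Re (place i \<xi>) = real i * (3 * real m)" by (simp add: place_def)
    moreover consider "i \<le> k" | "Suc k \<le> i" by linarith
    ultimately show False
      using zone_upper m_pos by cases (auto simp del: of_nat_Suc)
  next
    case (zone_lower k)
    consider "i < k" | "i = k" | "i = Suc k" | "Suc k < i" by linarith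
    then show False
      using zone_lower Re_place_bounds[OF assms, of i] strip_mono[of i k] strip_mono[of "Suc k" i] m_pos
      by cases (auto simp del: of_nat_Suc)
  next
    case zone_closing
    have "drop_left i * \<xi> 0 + drop_right i * \<xi> 1 = 2 * real m + \<xi> 2"
      using zone_closing(2) by (simp add: place_def)
    moreover have "drop_left i = 1 \<or> drop_right i = 1"
      using two_le_a by (auto simp: drop_left_def drop_right_def)
    ultimately have "i = 0 \<and> \<xi> 0 = real m \<and> \<xi> 1 = 0 \<or> i = a - 1 \<and> \<xi> 1 = real m \<and> \<xi> 0 = 0"
      using \<xi> m_pos by (auto simp: drop_left_def drop_right_def split: if_splits)
    then show False using zone_closing by (auto simp: place_def)
  qed
qed

lemma planar_graph: "planar graph"
proof (rule planar_straight_line[of graph edges pos])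
  show "parcs graph = edges \<union> edges\<inverse>" by simp
  show "inj_on pos (pverts graph)" using inj_on_pos by simp
  show "u \<in> pverts graph \<and> v \<in> pverts graph \<and> u \<noteq> v" if "(u, v) \<in> edges" for u v
    using edges_in_nodes[OF that] by simp
  have on_edge: "(\<exists>i \<xi>. p = place i \<xi> \<and> carries (u, v) i \<xi>) \<or> link_zone (u, v) p"
    if "(u, v) \<in> edges" "p \<in> open_segment (pos u) (pos v)" for u v p
    using that nest_edge_carries[of u v p] link_edge_zone[of u v p] by (auto simp: edges_def)
  show "pos w \<notin> open_segment (pos u) (pos v)" if uv: "(u, v) \<in> edges" and "w \<in> pverts graph" for u v w
  proof
    assume "pos w \<in> open_segment (pos u) (pos v)"
    moreover obtain i j c where w: "w = node i j c" "j \<le> m" "c < 3"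
      using \<open>w \<in> pverts graph\<close> by (auto elim: nodesE)
    then have "axis c (real j) \<in> nest_coords" by (auto intro: axis_in_nest_coords)
    ultimately show False
      using on_edge[OF uv] w carries_nest_coords place_inj[of i "axis c (real j)"]
        not_carries_axis place_not_link_zone by (metis pos_node)
  qed
  show "(u, v) = (x, y)"
    if "(u, v) \<in> edges" "(x, y) \<in> edges" "p \<in> open_segment (pos u) (pos v)" "p \<in> open_segment (pos x) (pos y)"
    for u v x y p
    using on_edge[OF that(1,3)] on_edge[OF that(2,4)]
      carries_unique carries_nest_coords place_inj place_not_link_zone link_zone_unique by metis
qed

subsection \<open>Three-connectedness\<close>

text \<open>A deletion spoils at most one column, and there are three columns but only two deletions.\<close>
lemma intact_column:
  assumes "finite X" and "card X < 3"
  shows "\<exists>c<3. \<forall>j>0. node i j c \<notin> X"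
proof (rule ccontr)
  assume "\<not> ?thesis"
  then have "\<forall>c. \<exists>j. c < 3 \<longrightarrow> 0 < j \<and> node i j c \<in> X" by blast
  then obtain f where f: "\<And>c. c < 3 \<Longrightarrow> 0 < f c \<and> node i (f c) c \<in> X" by metis
  have "inj_on (\<lambda>c. node i (f c) c) {..<3}"
    using f by (intro inj_onI) (metis lessThan_iff less_irrefl node_eq_iff)
  moreover have "(\<lambda>c. node i (f c) c) ` {..<3} \<subseteq> X" using f by auto
  ultimately have "card {..<3::nat} \<le> card X"
    using \<open>finite X\<close> by (rule card_inj_on_le)
  then show False using assms(2) by simp
qed

text \<open>
  The witness \<open>h\<close> is the outer corner of an intact column. Each level is a triangle, so every
  surviving vertex is adjacent to the intact column or lies on it, and the column leads to \<open>h\<close>.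
\<close>
lemma nest_connected:
  assumes i: "i < a" and "finite X" and "card X < 3"
  shows "\<exists>h\<in>nodes - X. \<forall>j\<le>m. \<forall>c<3. node i j c \<notin> X \<longrightarrow>
    (node i j c, h) \<in> (Restr (edges \<union> edges\<inverse>) (nodes - X))\<^sup>*"
proof -
  let ?R = "Restr (edges \<union> edges\<inverse>) (nodes - X)"
  obtain c where c: "c < 3" "\<And>j. 0 < j \<Longrightarrow> node i j c \<notin> X"
    using intact_column[OF assms(2,3)] by blast
  let ?h = "node i m c"
  have h: "?h \<in> nodes - X" using i c m_pos by (simp add: node_in_nodes_iff)
  have spoke: "(node i j c, node i (Suc j) c) \<in> ?R" if "j < m" "node i j c \<notin> X" for j
    using that i c nest_edges.spoke[of i j c] by (auto simp: edges_def node_in_nodes_iff)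
  have side: "(node i j d, node i j c) \<in> ?R" if "0 < j" "j \<le> m" "d < 3" "d \<noteq> c" "node i j d \<notin> X" for j d
    using that i c nest_edges.side[of i j c d] nest_edges.side[of i j d c]
    by (cases "c < d") (auto simp: edges_def node_in_nodes_iff)
  have column: "(node i j c, ?h) \<in> ?R\<^sup>*" if "0 < j" "j \<le> m" for j
    using that(2,1)
  proof (induction rule: inc_induct)
    case (step n)
    then show ?case using spoke[of n] c by (meson converse_rtrancl_into_rtrancl zero_less_Suc)
  qed simp
  have "(node i j d, ?h) \<in> ?R\<^sup>*" if "j \<le> m" "d < 3" "node i j d \<notin> X" for j d
  proof (cases "j = 0")
    case True
    then have "node i j d = node i 0 c" by (simp add: node_eq_iff)
    then show ?thesis
      using spoke[of 0] column[of "Suc 0"] m_pos that(3) by (auto intro: converse_rtrancl_into_rtrancl)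
  next
    case False
    then show ?thesis
      using side[of j d] column[of j] that by (cases "d = c") (auto intro: converse_rtrancl_into_rtrancl)
  qed
  with h show ?thesis by blast
qed

text \<open>
  If both edges between nests \<open>b\<close> and \<open>b + 1\<close> are hit, then the two deleted vertices are an
  endpoint of each. They hit neither both edges of another pair of links, since a left or right
  corner belongs to at most one right-left edge, nor the closing edge, since its endpoints belong
  to no other link. So the ring is broken in at most one place.
\<close>
lemma graph_minus_connected:
  assumes X: "finite X" "card X < 3" and uv: "u \<in> nodes - X" "v \<in> nodes - X"
  shows "(u, v) \<in> (Restr (edges \<union> edges\<inverse>) (nodes - X))\<^sup>*"
proof -
  let ?R = "Restr (edges \<union> edges\<inverse>) (nodes - X)"
  have "\<forall>i. \<exists>h. i < a \<longrightarrow> (\<forall>j\<le>m. \<forall>c<3. node i j c \<notin> X \<longrightarrow> (node i j c, h) \<in> ?R\<^sup>*)"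
    using nest_connected[OF _ X] by blast
  then obtain h where h: "\<And>i j c. i < a \<Longrightarrow> j \<le> m \<Longrightarrow> c < 3 \<Longrightarrow> node i j c \<notin> X \<Longrightarrow>
      (node i j c, h i) \<in> ?R\<^sup>*"
    by metis
  have sym: "(x, y) \<in> ?R\<^sup>* \<Longrightarrow> (y, x) \<in> ?R\<^sup>*" for x y
    by (rule symD[OF sym_rtrancl]) (auto intro: symI)
  \<comment> \<open>\<open>L i k\<close>: what survives of the nests \<open>i\<close> and \<open>k\<close> lies in one component.\<close>
  define L where "L i k \<longleftrightarrow> (h i, h k) \<in> ?R\<^sup>*" for i k
  have L_refl: "L i i" for i by (simp add: L_def)
  have L_trans: "L i k \<Longrightarrow> L k l \<Longrightarrow> L i l" for i k l by (auto simp: L_def)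
  have L_sym: "L i k \<Longrightarrow> L k i" for i k using sym by (auto simp: L_def)
  have edge: "L i k"
    if "(node i m c, node k m d) \<in> edges" "node i m c \<notin> X" "node k m d \<notin> X"
      "i < a" "k < a" "c < 3" "d < 3" for i k c d
  proof -
    have "(node i m c, node k m d) \<in> ?R"
      using that edges_in_nodes by blast
    then show ?thesis
      using sym h[of i m c] h[of k m d] that unfolding L_def
      by (meson order_refl r_into_rtrancl rtrancl_trans)
  qed
  have link: "L i (Suc i)"
    if "Suc i < a" and "node i m 2 \<notin> X \<and> node (Suc i) m 2 \<notin> X \<or>
      node i m 1 \<notin> X \<and> node (Suc i) m 0 \<notin> X" for i
    using that edge[of i 2 "Suc i" 2] edge[of i 1 "Suc i" 0] upper[of i] lower[of i]
    by (auto simp: edges_def)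
  have all_linked: "L 0 i" if "i < a" for i
  proof (cases "\<exists>i. Suc i < a \<and> \<not> L i (Suc i)")
    case False
    then show ?thesis using that
    proof (induction i)
      case (Suc i)
      then show ?case using L_trans[of 0 i "Suc i"] by auto
    qed (rule L_refl)
  next
    case True
    then obtain b where b: "Suc b < a" "\<not> L b (Suc b)" by blast
    then obtain x y where xy: "x \<in> X" "y \<in> X" "x = node b m 2 \<or> x = node (Suc b) m 2"
        "y = node b m 1 \<or> y = node (Suc b) m 0"
      using link[OF b(1)] by blast
    then have "x \<noteq> y" using m_pos by (auto simp: node_eq_iff)
    \<comment> \<open>The two deletions are used up at the broken pair of links, so all others are intact.\<close>
    have "X = {x, y}"
      by (rule card_seteq[symmetric]) (use X xy \<open>x \<noteq> y\<close> in auto)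
    then have only: "L k (Suc k)" if "Suc k < a" "k \<noteq> b" for k
      using that xy m_pos by (intro link) (auto simp: node_eq_iff)
    have "L 0 (a - 1)"
      using \<open>X = {x, y}\<close> xy m_pos b(1) closing
      by (intro edge[of 0 0 "a - 1" 1]) (auto simp: node_eq_iff edges_def)
    moreover have "L 0 k" if "k \<le> b" for k
      using that
    proof (induction k)
      case (Suc k)
      then show ?case using only[of k] b(1) L_trans[of 0 k "Suc k"] by auto
    qed (rule L_refl)
    moreover have "L k (a - 1)" if "k \<le> a - 1" "b < k" for k
      using that
    proof (induction rule: inc_induct)
      case (step n)
      then show ?case using only[of n] L_trans[of n "Suc n" "a - 1"] by auto
    qed (rule L_refl)
    ultimately show ?thesis
      using that L_sym[of i "a - 1"] L_trans[of 0 "a - 1" i] by (cases "i \<le> b") auto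
  qed
  have "\<exists>i<a. (w, h i) \<in> ?R\<^sup>*" if "w \<in> nodes - X" for w
    using that h by (metis DiffD1 DiffD2 nodesE)
  then obtain i k where "i < a" "(u, h i) \<in> ?R\<^sup>*" "k < a" "(v, h k) \<in> ?R\<^sup>*"
    using uv by meson
  moreover have "(h i, h k) \<in> ?R\<^sup>*"
    using all_linked[OF \<open>i < a\<close>] all_linked[OF \<open>k < a\<close>] L_sym L_trans unfolding L_def by blast
  ultimately show ?thesis using sym by (meson rtrancl_trans)
qed

lemma vertex_connected_graph: "vertex_connected 3 graph"
  unfolding vertex_connected_def
proof (intro conjI allI impI)
  have "2 * 4 \<le> a * (1 + 3 * m)"
    using two_le_a m_pos by (intro mult_le_mono) auto
  then show big: "3 < card (pverts graph)" by (simp add: card_nodes)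
  fix X assume X: "X \<subseteq> pverts graph" "card X < 3"
  have fin: "finite X"
    using X(1) finite_subset[of X nodes] by (simp add: nodes_def)
  have "nodes - X \<noteq> {}"
  proof
    assume "nodes - X = {}"
    then have "nodes \<subseteq> X" by blast
    then show False using card_mono[OF fin, of nodes] X(2) big by simp
  qed
  moreover have "sym (parcs graph)" by (auto intro: symI)
  ultimately show "Digraph_Component.connected (with_proj graph \<restriction> (pverts graph - X))"
    using graph_minus_connected[OF fin X(2)] by (subst connected_induced_iff) auto
qed

lemma polyhedral_graph: "polyhedral graph"
  by (simp add: polyhedral_def pair_graph_graph planar_graph vertex_connected_graph)

subsection \<open>The apexes are far apart\<close>

text \<open>
  A function that changes by at most one along each edge, vanishes at the apex of nest \<open>i\<close>, and
  equals \<open>2m + 1\<close> at every other apex: on nest \<open>i\<close> it is the level, and elsewhere it continues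
  from \<open>m + 1\<close> on the outer triangles inwards.
\<close>
definition potential :: "nat \<Rightarrow> nat \<times> nat \<times> nat \<Rightarrow> nat" where
  "potential i v = (case v of (k, j, c) \<Rightarrow> if k = i then j else 2 * m + 1 - j)"

lemma potential_edge:
  assumes "(u, v) \<in> edges"
  shows "potential i v \<le> Suc (potential i u) \<and> potential i u \<le> Suc (potential i v)"
  using assms unfolding edges_def
proof
  assume "(u, v) \<in> nest_edges"
  then show ?thesis by cases (auto simp: potential_def node_def)
next
  assume "(u, v) \<in> link_edges"
  then show ?thesis by cases (auto simp: potential_def node_def)
qed

lemma potential_walk:
  assumes "(u, v) \<in> (edges \<union> edges\<inverse>) ^^ n"
  shows "potential i v \<le> potential i u + n"
  using assms
proof (induction n arbitrary: v)
  case (Suc n)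
  then obtain w where "(u, w) \<in> (edges \<union> edges\<inverse>) ^^ n" "(w, v) \<in> edges \<union> edges\<inverse>" by auto
  then have "potential i w \<le> potential i u + n" "potential i v \<le> Suc (potential i w)"
    using Suc.IH potential_edge[of w v i] potential_edge[of v w i] by auto
  then show ?case by simp
qed simp

lemma k_independent_apexes: "k_independent (2 * m) graph ((\<lambda>i. node i 0 0) ` {..<a})"
  unfolding k_independent_def
proof (intro conjI ballI impI)
  show "(\<lambda>i. node i 0 0) ` {..<a} \<subseteq> pverts graph"
    by (auto simp: node_in_nodes_iff)
  fix u v assume "u \<in> (\<lambda>i. node i 0 0) ` {..<a}" "v \<in> (\<lambda>i. node i 0 0) ` {..<a}" "u \<noteq> v"
  then obtain i k where ik: "u = node i 0 0" "i < a" "v = node k 0 0" "k \<noteq> i" by auto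
  have "pair_wf_digraph graph"
    using pair_graph_graph by (simp add: pair_graph_def pair_digraph_def pair_fin_digraph_def)
  moreover have "u \<in> pverts graph" using ik by (simp add: node_in_nodes_iff)
  moreover have "(u, v) \<notin> parcs graph ^^ n" if "n \<le> 2 * m" for n
    using potential_walk[of u v n i] that ik by (auto simp: potential_def node_def)
  ultimately show "ereal (real (2 * m)) < graph_dist graph u v"
    by (simp only: graph_dist_gt_iff) blast
qed

lemma order_attained: "a * (1 + 3 * m) \<in> polyhedral_orders (2 * m) a"
proof -
  let ?G = "map_graph to_nat graph" and ?A = "(\<lambda>i. node i 0 0) ` {..<a}"
  have inj: "inj (to_nat :: nat \<times> nat \<times> nat \<Rightarrow> nat)" by simp
  have "polyhedral ?G"
    by (rule polyhedral_map_graph[OF polyhedral_graph inj])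
  moreover have "k_independent (2 * m) ?G (to_nat ` ?A)"
    by (rule k_independent_map_graph[OF k_independent_apexes pair_graph_graph inj])
  moreover have "card ?A = a"
    by (subst card_image) (auto simp: inj_on_def node_eq_iff)
  then have "card (to_nat ` ?A) = a"
    using inj by (subst card_image) (auto intro: inj_on_subset)
  moreover have "card (pverts ?G) = a * (1 + 3 * m)"
    using inj by (simp add: card_image inj_on_subset card_nodes)
  ultimately show ?thesis
    unfolding polyhedral_orders_def by (intro CollectI exI[of _ ?G]) auto
qed

end

section \<open>The minimal order\<close>

theorem theorem1p4:
  fixes a k :: nat
  assumes "a \<ge> 2" and "even k" and "k > 0"
  shows "min_polyhedral_order k a \<in> polyhedral_orders k a
    \<and> real (min_polyhedral_order k a) = real a + 3 * real a * (real k / 2)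
    \<and> real a + 3 * real a * (real k / 2) = (3 / 2 * real k + 1) * real a"
proof -
  from \<open>even k\<close> obtain m where k: "k = 2 * m" by (elim evenE)
  have attained: "a * (1 + 3 * m) \<in> polyhedral_orders k a"
    using assms k nest_ring.order_attained[of a m] by (simp add: nest_ring_def)
  have lower: "a * (1 + 3 * m) \<le> n" if n: "n \<in> polyhedral_orders k a" for n
  proof -
    from n obtain G :: "nat pair_pre_digraph" and S where "n = card (pverts G)"
        "polyhedral G" "k_independent k G S" "card S = a"
      unfolding polyhedral_orders_def by blast
    then show ?thesis
      using order_lower_bound[of G 3 m S] assms(1) k by (simp add: polyhedral_def)
  qed
  have "min_polyhedral_order k a = a * (1 + 3 * m)"
    unfolding min_polyhedral_order_def using attained lower by (rule Least_equality)
  then show ?thesis using attained by (simp add: k algebra_simps)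
qed

end
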